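(* Let $w$ be a nonempty word of length $n$ over a finite alphabet, and let $S^\circ(w)$ denote the number of distinct squares of length at most $n$ that occur in $w$ read cyclically. Then \[ S^\circ(w)\le\left\lfloor\frac{3n}{2}\right\rfloor . \]
   Context: A word is a finite sequence of letters from a finite alphabet. A square is a word of the form $xx$ with $x$ a nonempty word. For a word $w$ of length $n\ge 1$, let $W=w^{\mathbb Z}$ be the bi-infinite periodic word indexed by $\mathbb Z$ with $W[1..n]=w$ and $W[i+n]=W[i]$ for all $i\in\mathbb Z$. A factor of $W$ is a finite word $W[i..j]=W[i]W[i+1]\cdots W[j]$. Then $S^\circ(w)$ is the number of distinct words of the form $xx$, with $x$ nonempty and $2|x|\le n$, that are factors of $W$ (so occurrences may cross the boundary between the last and first letters of $w$, and equal square words are counted once). *)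

theory Defs
  imports Complex_Main
begin

text \<open>The bi-infinite word is indexed so that positions \<open>1..n\<close> carry the word itself, while
  list indices start at \<open>0\<close>; it is meaningful for nonempty words only.\<close>

definition periodic_word :: "'a list \<Rightarrow> int \<Rightarrow> 'a" where
  "periodic_word w i = w ! nat ((i - 1) mod int (length w))"

lemma periodic_word_base: "map (periodic_word w) [1..int (length w)] = w"
  by (rule nth_equalityI) (auto simp: periodic_word_def)

lemma periodic_word_period: "periodic_word w (i + int (length w)) = periodic_word w i"
proof -
  have "i + int (length w) - 1 = (i - 1) + int (length w)"
    by simp
  then show ?thesis
    by (simp only: periodic_word_def mod_add_self2)
qed

definition factor :: "'a list \<Rightarrow> (int \<Rightarrow> 'a) \<Rightarrow> bool" where
  "factor u W \<longleftrightarrow> (\<exists>i j. u = map W [i..j])"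

definition square :: "'a list \<Rightarrow> bool" where
  "square u \<longleftrightarrow> (\<exists>x. x \<noteq> [] \<and> u = x @ x)"

definition cyclic_squares :: "'a list \<Rightarrow> 'a list set" where
  "cyclic_squares w = {u. square u \<and> length u \<le> length w \<and> factor u (periodic_word w)}"

definition num_cyclic_squares :: "'a list \<Rightarrow> nat" where
  "num_cyclic_squares w = card (cyclic_squares w)"

text \<open>The set being counted is finite, so the cardinality is the genuine one.\<close>

lemma finite_cyclic_squares:
  assumes "w \<noteq> []"
  shows "finite (cyclic_squares w)"
proof (rule finite_subset)
  have "periodic_word w i \<in> set w" for i
    using assms by (auto simp: periodic_word_def nat_less_iff intro!: nth_mem)
  then show "cyclic_squares w \<subseteq> {u. set u \<subseteq> set w \<and> length u \<le> length w}"
    by (auto simp: cyclic_squares_def factor_def)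
  show "finite {u. set u \<subseteq> set w \<and> length u \<le> length w}"
    by (rule finite_lists_length_le) simp
qed

end

theory Submission
  imports Defs "HOL-Library.List_Lexorder"
begin

text \<open>
  Let \<open>W\<close> be the bi-infinite word, \<open>n\<^sub>0\<close> its least period, \<open>C(l)\<close> the number of its factors of length
  \<open>l\<close> and \<open>g(l) = C(l + 1) - C(l)\<close>. The factors of length \<open>l + 1\<close> are the edges of the Rauzy graph
  of order \<open>l\<close>, whose vertices are the factors of length \<open>l\<close>; an edge leads from its prefix to its
  suffix. Since \<open>C(0) = 1\<close> and \<open>C(l) \<le> n\<^sub>0\<close>, the numbers \<open>g(l)\<close> sum to at most \<open>n\<^sub>0 - 1\<close>.

  A square is \<open>p\<^bsup>2k\<^esup>\<close> with \<open>p\<close> primitive. The conjugacy class of \<open>p\<close>, of length \<open>m\<close>, is represented by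
  the periodic word \<open>X\<close> with period word \<open>p\<close>, up to a shift; assume that it is not a shift of \<open>W\<close>,
  which is automatic if \<open>n = n\<^sub>0\<close> and the square has length at most \<open>n\<close>. At every order \<open>l \<ge> m\<close>
  for which all factors of \<open>X\<close> of length \<open>l + 1\<close> occur in \<open>W\<close>, the class is a circuit of length \<open>m\<close> of the graph;
  say that it is available there. These are the orders \<open>m \<le> l < lam X\<close>, where \<open>lam X\<close> is the
  largest length for which all factors of \<open>X\<close> occur in \<open>W\<close>. Distinct available circuits are
  linearly independent in the cycle space of the connected graph, so there are at most \<open>g(l) + 1\<close>
  of them (\<open>circuits_independent\<close>). Here independence comes from edges labelled by a word that
  starts with an unbordered conjugate of \<open>p\<close>: such a label has no period less than \<open>m\<close>. There are
  none if \<open>g(l) = 0\<close>, because then \<open>W\<close> would have to follow the circuit for ever.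

  Only squares of length at most \<open>n\<close> are counted. If \<open>k\<close> is the largest exponent among them and
  \<open>p\<^bsup>2k\<^esup>\<close> occurs in \<open>W\<close> for \<open>r\<close> conjugates \<open>p\<close>, the class has at most \<open>s = (k - 1) m + r\<close> squares,
  while \<open>lam X \<ge> (2k - 1) m + r\<close> (\<open>class_bounds\<close>). So the squares of the class can be charged to the
  \<open>s\<close> topmost orders at which it is available; say that it is used there. Let \<open>u(l)\<close> be the number of
  classes used at order \<open>l\<close>. From \<open>u(l) \<le> g(l) + 1 \<le> 2 g(l)\<close> for \<open>g(l) > 0\<close> one gets only
  \<open>2 (n\<^sub>0 - 1)\<close>.

  Let first \<open>n = n\<^sub>0\<close>. For \<open>3 n / 2\<close> the orders with \<open>g(l) = 1\<close> and \<open>u(l) = 2\<close>, called tight, must be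
  compensated. At such an order there is one branching vertex, \<open>W\<close> is a walk that
  runs through two loops \<open>X\<close>, \<open>Y\<close>, and it does not alternate between them, since \<open>n\<close> exceeds the
  sum of their lengths. So it takes one of them, say \<open>X\<close>, twice in a row, whence
  \<open>lam X \<ge> l + 1 + m\<close> (\<open>two_circuits\<close>). As \<open>2 s \<le> lam X\<close>, such an \<open>X\<close> has at least as many orders at
  which it is available but not used as it has tight orders to account for; at those orders
  \<open>u(l) \<le> g(l)\<close>. By the theorem of Fine and Wilf, the orders so attached to distinct classes are
  disjoint (\<open>no_two_long\<close>). Hence \<open>2 \<Sum> u(l) \<le> 3 \<Sum> g(l)\<close> (\<open>main_bound\<close>).

  If \<open>n = e n\<^sub>0\<close> with \<open>e \<ge> 2\<close>, the weaker bound \<open>2 (n\<^sub>0 - 1)\<close> suffices for the classes other than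
  that of \<open>W\<close> itself, which contributes at most \<open>n / 2\<close> squares.
\<close>

section \<open>Factors and periods of bi-infinite words\<close>

text \<open>The factor of length \<open>L\<close> that starts at position \<open>i\<close>, and the set of all factors of length \<open>L\<close>.\<close>

definition fac :: "(int \<Rightarrow> 'a) \<Rightarrow> int \<Rightarrow> nat \<Rightarrow> 'a list" where
  "fac X i L = map (\<lambda>j. X (i + int j)) [0..<L]"

definition facs :: "(int \<Rightarrow> 'a) \<Rightarrow> nat \<Rightarrow> 'a list set" where
  "facs X L = range (\<lambda>i. fac X i L)"

lemma length_fac [simp]: "length (fac X i L) = L"
  by (simp add: fac_def)

lemma fac_eq_iff: "fac X i L = fac Y j L \<longleftrightarrow> (\<forall>t<L. X (i + int t) = Y (j + int t))"
  by (auto simp: fac_def list_eq_iff_nth_eq)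

lemma take_fac: "l \<le> L \<Longrightarrow> take l (fac X i L) = fac X i l"
  by (simp add: fac_def take_map)

lemma tl_fac: "tl (fac X i (Suc l)) = fac X (i + 1) l"
  by (rule nth_equalityI) (auto simp: fac_def nth_tl algebra_simps simp del: upt_Suc)

lemma fac_in_facs [simp, intro]: "fac X i L \<in> facs X L"
  by (simp add: facs_def)

lemma facs_mono: "facs X L \<subseteq> facs W L \<Longrightarrow> l \<le> L \<Longrightarrow> facs X l \<subseteq> facs W l"
proof
  fix x assume a: "facs X L \<subseteq> facs W L" "l \<le> L" "x \<in> facs X l"
  then obtain i where i: "x = fac X i l" by (auto simp: facs_def)
  have "fac X i L \<in> facs W L" using a by auto
  then obtain j where "fac X i L = fac W j L" by (auto simp: facs_def)
  then have "take l (fac X i L) = take l (fac W j L)" by simp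
  then show "x \<in> facs W l" using a i by (simp add: take_fac)
qed

text \<open>Periods are positive by definition.\<close>

definition has_period :: "(int \<Rightarrow> 'a) \<Rightarrow> nat \<Rightarrow> bool" where
  "has_period X p \<longleftrightarrow> 0 < p \<and> (\<forall>i. X (i + int p) = X i)"

lemma has_period_pos: "has_period X p \<Longrightarrow> 0 < p"
  by (simp add: has_period_def)

lemma has_period_mult: assumes "has_period X p" shows "X (i + int p * k) = X i"
proof -
  have *: "X (i + int p * int n) = X i" for i n
  proof (induction n)
    case (Suc n)
    have "X (i + int p * int (Suc n)) = X ((i + int p * int n) + int p)"
      by (simp add: algebra_simps)
    also have "\<dots> = X i" using assms Suc by (simp add: has_period_def)
    finally show ?case .
  qed simp
  show ?thesis
  proof (cases "0 \<le> k")
    case True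
    then show ?thesis using *[of i "nat k"] by simp
  next
    case False
    then show ?thesis using *[of "i + int p * k" "nat (-k)"] by (simp add: algebra_simps)
  qed
qed

lemma has_period_cong: assumes "has_period X p" "i mod int p = j mod int p" shows "X i = X j"
proof -
  obtain k where "i - j = int p * k"
    using assms(2) by (auto simp: mod_eq_dvd_iff)
  then have "i = j + int p * k" by simp
  then show ?thesis using has_period_mult[OF assms(1), of j k] by simp
qed

text \<open>Two words with a common period that agree on one period agree everywhere.\<close>

lemma has_period_agreeI:
  assumes "has_period X p" "has_period Y p" "\<And>t. t < p \<Longrightarrow> X (i + int t) = Y (j + int t)"
  shows "X (i + k) = Y (j + k)"
proof -
  have p: "0 < int p" using has_period_pos[OF assms(1)] by simp
  have "X (i + k) = X (i + k mod int p)" by (rule has_period_cong[OF assms(1)]) (simp add: mod_simps)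
  also have "\<dots> = Y (j + k mod int p)"
    using assms(3)[of "nat (k mod int p)"] p by (simp add: nat_less_iff)
  also have "\<dots> = Y (j + k)" by (rule has_period_cong[OF assms(2)]) (simp add: mod_simps)
  finally show ?thesis .
qed

text \<open>A weak form of the theorem of Fine and Wilf.\<close>

lemma fine_wilf:
  assumes X: "has_period X p" and Y: "has_period Y q"
    and agree: "\<And>t. t < p + q \<Longrightarrow> X (i + int t) = Y (j + int t)"
  shows "X (i + k) = Y (j + k)"
proof -
  have "X (i + int q + int t) = X (i + int t)" if "t < p" for t
  proof -
    have "X (i + int q + int t) = Y (j + int t + int q)"
      using agree[of "q + t"] that by (simp add: algebra_simps)
    also have "\<dots> = X (i + int t)" using agree[of t] that Y by (simp add: has_period_def)
    finally show ?thesis .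
  qed
  then have "X (i + int q + k) = X (i + k)" for k
    by (rule has_period_agreeI[OF X X])
  then have "X (i + int q + (k - i)) = X (i + (k - i))" for k .
  then have "X (k + int q) = X k" for k
    by (simp add: algebra_simps)
  then have "has_period X q" using Y by (simp add: has_period_def)
  then show ?thesis by (rule has_period_agreeI[OF _ Y]) (simp add: agree)
qed

text \<open>The least period. It is meaningful for periodic words only, which is expressed by assuming
  \<open>has_period X (min_period X)\<close>.\<close>

definition min_period :: "(int \<Rightarrow> 'a) \<Rightarrow> nat" where
  "min_period X = (LEAST p. has_period X p)"

lemma has_period_min_period: "has_period X p \<Longrightarrow> has_period X (min_period X)"
  unfolding min_period_def by (rule LeastI)

lemma min_period_le: "has_period X p \<Longrightarrow> min_period X \<le> p"
  unfolding min_period_def by (rule Least_le)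

lemma min_period_dvd: assumes "has_period X p" shows "min_period X dvd p"
proof (rule ccontr)
  let ?m = "min_period X"
  assume "\<not> ?m dvd p"
  then have pos: "0 < p mod ?m" by (simp add: mod_greater_zero_iff_not_dvd)
  have m: "has_period X ?m" using assms by (rule has_period_min_period)
  have "X (i + int (p mod ?m)) = X i" for i
  proof -
    have "X (i + int (p mod ?m)) = X (i + int p)"
      by (rule has_period_cong[OF m]) (simp add: zmod_int mod_simps)
    then show ?thesis using assms by (simp add: has_period_def)
  qed
  then have "has_period X (p mod ?m)" using pos by (simp add: has_period_def)
  then have "?m \<le> p mod ?m" by (rule min_period_le)
  then show False using has_period_pos[OF m] mod_less_divisor[of ?m p] by linarith
qed

lemma min_period_dvd_diff:
  assumes "has_period X p" "fac X i L = fac X j L" "min_period X \<le> L" shows "int (min_period X) dvd i - j"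
proof -
  let ?m = "min_period X"
  have m: "has_period X ?m" using assms by (blast intro: has_period_min_period)
  have eq: "X (i + k) = X (j + k)" for k
    using assms(2,3) by (intro has_period_agreeI[OF m m, of i j k]) (simp add: fac_eq_iff)
  show ?thesis
  proof (cases "i = j")
    case False
    have "X (k + int (nat \<bar>i - j\<bar>)) = X k" for k
      using eq[of "k - i"] eq[of "k - j"] by (cases "i \<le> j") (simp_all add: algebra_simps)
    then have "has_period X (nat \<bar>i - j\<bar>)" using False by (simp add: has_period_def)
    then have "?m dvd nat \<bar>i - j\<bar>" by (rule min_period_dvd)
    then show ?thesis by (metis int_dvd_int_iff dvd_abs_iff int_nat_eq abs_ge_zero)
  qed simp
qed

text \<open>Equality up to a shift. Conjugacy classes of primitive words correspond to the classes of
  periodic words under this relation.\<close>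

definition shift_eq :: "(int \<Rightarrow> 'a) \<Rightarrow> (int \<Rightarrow> 'a) \<Rightarrow> bool" where
  "shift_eq X Y \<longleftrightarrow> (\<exists>k. \<forall>i. Y i = X (i + k))"

lemma shift_eq_refl [simp]: "shift_eq X X"
  unfolding shift_eq_def by (rule exI[of _ 0]) simp

lemma shift_eq_sym: "shift_eq X Y \<Longrightarrow> shift_eq Y X"
proof -
  assume "shift_eq X Y"
  then obtain k where "\<And>i. Y i = X (i + k)" by (auto simp: shift_eq_def)
  then have "\<forall>i. X i = Y (i + - k)" by simp
  then show "shift_eq Y X" unfolding shift_eq_def by blast
qed

lemma shift_eq_trans: "shift_eq X Y \<Longrightarrow> shift_eq Y Z \<Longrightarrow> shift_eq X Z"
proof -
  assume "shift_eq X Y" "shift_eq Y Z"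
  then obtain k l where "\<And>i. Y i = X (i + k)" "\<And>i. Z i = Y (i + l)" by (auto simp: shift_eq_def)
  then have "\<forall>i. Z i = X (i + (l + k))" by (simp add: add.assoc)
  then show "shift_eq X Z" unfolding shift_eq_def by blast
qed

lemma shift_eqI: "(\<And>k. X (i + k) = Y (j + k)) \<Longrightarrow> shift_eq X Y"
proof -
  assume a: "\<And>k. X (i + k) = Y (j + k)"
  have "Y k = X (k + (i - j))" for k using a[of "k - j"] by (simp add: algebra_simps)
  then show ?thesis unfolding shift_eq_def by blast
qed

lemma facs_shift_eq: assumes "shift_eq X Y" shows "facs X L = facs Y L"
proof -
  have "facs Y L \<subseteq> facs X L" if s: "shift_eq X Y" for X Y :: "int \<Rightarrow> 'a"
  proof -
    obtain k where "\<And>i. Y i = X (i + k)" using s by (auto simp: shift_eq_def)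
    then have "fac Y i L = fac X (i + k) L" for i by (simp add: fac_def algebra_simps)
    then show ?thesis by (auto simp: facs_def)
  qed
  then show ?thesis using assms shift_eq_sym by blast
qed

lemma has_period_shift_eq: assumes "shift_eq X Y" shows "has_period X p = has_period Y p"
proof -
  have "has_period Y p" if s: "shift_eq X Y" and "has_period X p" for X Y :: "int \<Rightarrow> 'a"
  proof -
    obtain k where "\<And>i. Y i = X (i + k)" using s by (auto simp: shift_eq_def)
    moreover have "X (i + int p + k) = X (i + k)" for i
      using that(2) unfolding has_period_def by (metis add.assoc add.commute)
    ultimately show ?thesis using that(2) by (simp add: has_period_def)
  qed
  then show ?thesis using assms shift_eq_sym by blast
qed

lemma min_period_shift_eq: "shift_eq X Y \<Longrightarrow> min_period X = min_period Y"
proof -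
  assume "shift_eq X Y"
  then have "has_period X = has_period Y" using has_period_shift_eq by blast
  then show "min_period X = min_period Y" by (simp add: min_period_def)
qed

lemma finite_facs: assumes "has_period X p" shows "finite (facs X L)" "card (facs X L) \<le> p"
proof -
  have "facs X L = (\<lambda>t. fac X (int t) L) ` {..<p}"
  proof
    show "facs X L \<subseteq> (\<lambda>t. fac X (int t) L) ` {..<p}"
    proof
      fix x assume "x \<in> facs X L"
      then obtain i where i: "x = fac X i L" by (auto simp: facs_def)
      have p: "0 < int p" using has_period_pos[OF assms] by simp
      have "fac X i L = fac X (int (nat (i mod int p))) L"
        unfolding fac_eq_iff
      proof (intro allI impI has_period_cong[OF assms])
        fix t show "(i + int t) mod int p = (int (nat (i mod int p)) + int t) mod int p"
          using p by (simp add: mod_simps)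
      qed
      moreover have "nat (i mod int p) < p" using p by (simp add: nat_less_iff)
      ultimately show "x \<in> (\<lambda>t. fac X (int t) L) ` {..<p}" using i by blast
    qed
  qed auto
  then show "finite (facs X L)" "card (facs X L) \<le> p"
    by (auto intro: order.trans[OF card_image_le])
qed

text \<open>A primitive word has an unbordered conjugate: the lexicographically least one. Its being
  unbordered is expressed as the absence of a period shorter than its length. Since the alphabet
  carries no order, it is first mapped injectively into the natural numbers.\<close>

lemma unbordered_factor:
  assumes "has_period X p0"
  obtains i where "\<And>p. 0 < p \<Longrightarrow> p < min_period X \<Longrightarrow> \<exists>j. j + p < min_period X \<and> X (i + int j) \<noteq> X (i + int (j + p))"
proof -
  let ?m = "min_period X"
  have m: "has_period X ?m" using assms by (rule has_period_min_period)
  have "range X \<subseteq> hd ` facs X 1"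
  proof
    fix x assume "x \<in> range X"
    then obtain i where "x = X i" by auto
    then have "x = hd (fac X i 1)" by (simp add: fac_def)
    then show "x \<in> hd ` facs X 1" by auto
  qed
  then have "finite (range X)" using finite_facs(1)[OF m] finite_surj by blast
  then obtain f :: "'a \<Rightarrow> nat" where f: "inj_on f (range X)"
    using finite_imp_inj_to_nat_seg by blast
  let ?Y = "\<lambda>i. f (X i)"
  have "has_period ?Y ?m" using m by (simp add: has_period_def)
  then have fin: "finite (facs ?Y ?m)" by (rule finite_facs)
  define u where "u = Min (facs ?Y ?m)"
  have "u \<in> facs ?Y ?m" unfolding u_def using fin by (intro Min_in) auto
  then obtain i where i: "u = fac ?Y i ?m" by (auto simp: facs_def)
  have min: "u \<le> fac ?Y k ?m" for k unfolding u_def using fin by (intro Min_le) auto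
  show ?thesis
  proof (rule that, rule ccontr)
    fix p assume p: "0 < p" "p < ?m" and "\<not> (\<exists>j. j + p < ?m \<and> X (i + int j) \<noteq> X (i + int (j + p)))"
    then have eq: "X (i + int j) = X (i + int p + int j)" if "j + p < ?m" for j
      using that by (auto simp: algebra_simps)
    define x where "x = fac ?Y i (?m - p)"
    define y where "y = fac ?Y (i + int (?m - p)) p"
    define z where "z = fac ?Y i p"
    have app: "fac ?Y k (a + b) = fac ?Y k a @ fac ?Y (k + int a) b" for k a b
      by (rule nth_equalityI) (auto simp: fac_def nth_append)
    have x': "fac ?Y (i + int p) (?m - p) = x"
      using eq p unfolding x_def fac_eq_iff by (metis less_diff_conv)
    have xx': "fac ?Y (i + int ?m) k = fac ?Y i k" for k
      unfolding fac_eq_iff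
    proof (intro allI impI)
      fix t
      have "i + int ?m + int t = i + int t + int ?m" by simp
      then show "f (X (i + int ?m + int t)) = f (X (i + int t))"
        using m by (simp only: has_period_def)
    qed
    have u1: "u = x @ y" using app[of i "?m - p" p] p by (simp add: i x_def y_def)
    have u2: "u = z @ x" using app[of i p "?m - p"] p x' by (simp add: i z_def)
    have r1: "fac ?Y (i + int p) ?m = x @ z"
      using app[of "i + int p" "?m - p" p] p x' xx'[of p] by (simp add: z_def algebra_simps)
    have r2: "fac ?Y (i + int (?m - p)) ?m = y @ x"
      using app[of "i + int (?m - p)" p "?m - p"] p xx'[of "?m - p"]
      by (simp add: y_def x_def algebra_simps)
    \<comment> \<open>If \<open>x\<close> is a border of the least conjugate \<open>u = x y = z x\<close>, compare \<open>u\<close> with \<open>x z\<close> and \<open>y x\<close>.\<close>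
    have "\<not> z < y"
    proof
      assume "z < y"
      then have "x @ z < x @ y" by (simp add: list_less_def lexord_append_leftI)
      then show False using min[of "i + int p"] r1 u1 by simp
    qed
    moreover have "\<not> y < z"
    proof
      assume "y < z"
      then have "y @ x < z @ x" unfolding list_less_def
        by (rule lexord_sufI) (simp add: y_def z_def)
      then show False using min[of "i + int (?m - p)"] r2 u2 by simp
    qed
    ultimately have "y = z" by auto
    then have "fac ?Y (i + int p) ?m = fac ?Y i ?m" using r1 u1 i by simp
    then have "fac X (i + int p) ?m = fac X i ?m"
      using f by (auto simp: fac_eq_iff inj_on_def)
    then have "int ?m dvd int p" using min_period_dvd_diff[OF m, of "i + int p" ?m i] by simp
    then show False using p by (auto dest: dvd_imp_le)
  qed
qed

lemma fac_eqD: "fac X i L = fac Y j L \<Longrightarrow> t < L \<Longrightarrow> X (i + int t) = Y (j + int t)"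
  by (simp add: fac_eq_iff)

section \<open>Rauzy graphs\<close>

lemma fac_SucD:
  assumes "fac X i (Suc l) = fac Y j (Suc l)"
  shows "fac X i l = fac Y j l" "fac X (i + 1) l = fac Y (j + 1) l"
proof -
  show "fac X i l = fac Y j l" using arg_cong[OF assms, of "take l"] by (simp add: take_fac)
  show "fac X (i + 1) l = fac Y (j + 1) l" using arg_cong[OF assms, of tl] by (simp add: tl_fac)
qed

lemma take_image_facs: "take l ` facs W (Suc l) = facs W l"
  by (auto simp: facs_def take_fac image_image)

lemma facs_window:
  assumes X: "has_period X p" and eq: "fac W j N = fac X i N" and L: "L + p \<le> Suc N"
  shows "facs X L \<subseteq> facs W L"
proof
  fix x assume "x \<in> facs X L"
  then obtain a where a: "x = fac X a L" by (auto simp: facs_def)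
  have p: "0 < int p" using has_period_pos[OF X] by simp
  define t where "t = nat ((a - i) mod int p)"
  have t: "int t = (a - i) mod int p" "t < p" using p by (auto simp: t_def nat_less_iff)
  have "fac W (j + int t) L = x"
    unfolding a fac_eq_iff
  proof (intro allI impI)
    fix s assume "s < L"
    then have "W (j + int (t + s)) = X (i + int (t + s))"
      using \<open>s < L\<close> t(2) L by (intro fac_eqD[OF eq]) simp
    also have "\<dots> = X (a + int s)"
    proof (rule has_period_cong[OF X])
      have "i + int (t + s) - (a + int s) = int p * - ((a - i) div int p)"
        by (simp add: t(1) minus_mult_div_eq_mod[symmetric])
      then show "(i + int (t + s)) mod int p = (a + int s) mod int p"
        unfolding mod_eq_dvd_iff by (metis dvd_triv_left)
    qed
    finally show "W (j + int t + int s) = X (a + int s)" by (simp add: algebra_simps)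
  qed
  then show "x \<in> facs W L" by (metis fac_in_facs)
qed

text \<open>If a walk of \<open>W\<close> is at a vertex of \<open>X\<close>, it keeps to the edges of \<open>X\<close> as long as \<open>W\<close> has no
  other edge leaving the vertices met.\<close>

lemma follow:
  assumes "fac W j l = fac X i l"
    and "\<And>t e. t < T \<Longrightarrow> e \<in> facs W (Suc l) \<Longrightarrow> take l e = fac X (i + int t) l
           \<Longrightarrow> e = fac X (i + int t) (Suc l)"
  shows "fac W j (l + T) = fac X i (l + T)"
  using assms(2)
proof (induction T)
  case 0
  then show ?case using assms(1) by simp
next
  case (Suc T)
  then have IH: "fac W j (l + T) = fac X i (l + T)" by simp
  have "W (j + int T + int t) = X (i + int T + int t)" if "t < l" for t
  proof -
    have "W (j + int (T + t)) = X (i + int (T + t))" using that by (intro fac_eqD[OF IH]) simp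
    then show ?thesis by (simp add: algebra_simps)
  qed
  then have "take l (fac W (j + int T) (Suc l)) = fac X (i + int T) l"
    by (simp add: take_fac fac_eq_iff)
  then have "fac W (j + int T) (Suc l) = fac X (i + int T) (Suc l)"
    by (intro Suc.prems) auto
  then have "W (j + int T + int l) = X (i + int T + int l)" unfolding fac_eq_iff by blast
  then have "W (j + int (l + T)) = X (i + int (l + T))" by (simp add: algebra_simps)
  then show ?case using IH unfolding fac_eq_iff by (metis add_Suc_right less_Suc_eq)
qed

text \<open>A circuit of a Rauzy graph of \<open>W\<close> without a branching vertex cannot be left, so it is all of
  \<open>W\<close>.\<close>

lemma unbranched_circuit:
  assumes W: "has_period W n" and X: "has_period X m" and sub: "facs X (Suc l) \<subseteq> facs W (Suc l)"
    and det: "\<And>t e. e \<in> facs W (Suc l) \<Longrightarrow> take l e = fac X t l \<Longrightarrow> e = fac X t (Suc l)"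
  shows "shift_eq W X"
proof -
  have "facs X l \<subseteq> facs W l" using sub by (rule facs_mono) simp
  then have "fac X 0 l \<in> facs W l" by blast
  then obtain j where "fac W j l = fac X 0 l" by (auto simp: facs_def)
  then have "fac W j (l + (n + m)) = fac X 0 (l + (n + m))"
    using det by (intro follow) auto
  then have "W (j + int t) = X (0 + int t)" if "t < n + m" for t
    using that unfolding fac_eq_iff by simp
  then have "W (j + k) = X (0 + k)" for k by (rule fine_wilf[OF W X])
  then show ?thesis by (rule shift_eqI)
qed

lemma card_facs_mono: "has_period W n \<Longrightarrow> card (facs W l) \<le> card (facs W (Suc l))"
  using card_image_le[of "facs W (Suc l)" "take l"] by (simp add: take_image_facs finite_facs)

lemma unbranched_level:
  assumes W: "has_period W n" and X: "has_period X m" and sub: "facs X (Suc l) \<subseteq> facs W (Suc l)"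
    and card: "card (facs W (Suc l)) \<le> card (facs W l)"
  shows "shift_eq W X"
proof (rule unbranched_circuit[OF W X sub])
  fix t e assume e: "e \<in> facs W (Suc l)" "take l e = fac X t l"
  have "inj_on (take l) (facs W (Suc l))"
  proof (rule eq_card_imp_inj_on)
    show "finite (facs W (Suc l))" by (rule finite_facs[OF W])
    show "card (take l ` facs W (Suc l)) = card (facs W (Suc l))"
      using card card_facs_mono[OF W, of l] by (simp add: take_image_facs)
  qed
  moreover have "fac X t (Suc l) \<in> facs W (Suc l)" using sub by blast
  moreover have "take l e = take l (fac X t (Suc l))" using e by (simp add: take_fac)
  ultimately show "e = fac X t (Suc l)" using e by (auto dest: inj_onD)
qed

lemma shift_eq_of_fac_eq:
  assumes "has_period X p" "has_period Y p" "fac X i L = fac Y j L" "p \<le> L" shows "shift_eq X Y"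
proof -
  have "X (i + k) = Y (j + k)" for k
    using assms(3,4) by (intro has_period_agreeI[OF assms(1,2), of i j k]) (simp add: fac_eq_iff)
  then show ?thesis by (rule shift_eqI)
qed

text \<open>The number of circuits of length at most \<open>l\<close> is bounded by the cyclomatic number of the Rauzy
  graph of order \<open>l\<close>. Each circuit gets a pivot edge that lies on no other circuit of the same or
  of smaller length. A set of vertices that avoids a base vertex is determined by the non-pivot
  edges that it cuts: whether the pivot of a circuit is cut follows from the remaining edges of the
  circuit, by induction on the length, and the graph is connected. Counting such sets gives
  \<open>2 ^ (C(l) - 1) \<le> 2 ^ (C(l + 1) - card A)\<close>.\<close>

lemma circuits_independent:
  fixes W :: "int \<Rightarrow> 'a"
  assumes W: "has_period W n" and A: "finite A"
    and has_period: "\<And>X. X \<in> A \<Longrightarrow> has_period X (min_period X)"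
    and le: "\<And>X. X \<in> A \<Longrightarrow> min_period X \<le> l"
    and sub: "\<And>X. X \<in> A \<Longrightarrow> facs X (Suc l) \<subseteq> facs W (Suc l)"
    and inequiv: "\<And>X Y. X \<in> A \<Longrightarrow> Y \<in> A \<Longrightarrow> shift_eq X Y \<Longrightarrow> X = Y"
  shows "card A + card (facs W l) \<le> card (facs W (Suc l)) + 1"
proof -
  let ?V = "facs W l" and ?E = "facs W (Suc l)"
  have finV: "finite ?V" and finE: "finite ?E" using finite_facs(1)[OF W] by auto
  have "\<forall>X\<in>A. \<exists>i. \<forall>p. 0 < p \<longrightarrow> p < min_period X \<longrightarrow> (\<exists>j. j + p < min_period X \<and> X (i + int j) \<noteq> X (i + int (j + p)))"
    using unbordered_factor[OF has_period] by metis
  then obtain pos where pos: "\<And>X p. X \<in> A \<Longrightarrow> 0 < p \<Longrightarrow> p < min_period X \<Longrightarrow>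
      \<exists>j. j + p < min_period X \<and> X (pos X + int j) \<noteq> X (pos X + int (j + p))" by metis
  define piv where "piv X = fac X (pos X) (Suc l)" for X
  have pivE: "piv X \<in> ?E" if "X \<in> A" for X using sub[OF that] by (auto simp: piv_def)
  have piv_other: "Y = X" if X: "X \<in> A" and Y: "Y \<in> A" and mem: "piv X \<in> facs Y (Suc l)"
    and mle: "min_period Y \<le> min_period X" for X Y
  proof -
    obtain k where k: "fac X (pos X) (Suc l) = fac Y k (Suc l)"
      using mem by (auto simp: facs_def piv_def)
    have "\<not> min_period Y < min_period X"
    proof
      assume lt: "min_period Y < min_period X"
      then obtain j where j: "j + min_period Y < min_period X" "X (pos X + int j) \<noteq> X (pos X + int (j + min_period Y))"
        using pos[OF X _ lt] has_period_pos[OF has_period[OF Y]] by auto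
      have eq: "X (pos X + int t) = Y (k + int t)" if "t < min_period X" for t
        using k le[OF X] that unfolding fac_eq_iff by simp
      moreover have "Y (k + int (j + min_period Y)) = Y (k + int j)"
        using has_period[OF Y] by (simp add: has_period_def add.assoc[symmetric])
      ultimately have "X (pos X + int (j + min_period Y)) = X (pos X + int j)"
        using j(1) eq[of j] eq[of "j + min_period Y"] by simp
      then show False using j(2) by simp
    qed
    then have "min_period Y = min_period X" using mle by simp
    then have "shift_eq X Y" using k has_period[OF X] has_period[OF Y] le[OF X]
      by (intro shift_eq_of_fac_eq[of X "min_period X" Y "pos X" "Suc l" k]) auto
    then show ?thesis using inequiv X Y by blast
  qed
  have inj_piv: "inj_on piv A"
  proof (rule inj_onI)
    fix X Y assume XY: "X \<in> A" "Y \<in> A" "piv X = piv Y"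
    have "piv X \<in> facs Y (Suc l)" "piv Y \<in> facs X (Suc l)"
      using XY by (metis piv_def fac_in_facs)+
    then show "X = Y" using piv_other XY by (metis nat_le_linear)
  qed
  let ?F = "?E - piv ` A"
  let ?v0 = "fac W 0 l"
  define cut where "cut B = {e \<in> ?F. (take l e \<in> B) \<noteq> (tl e \<in> B)}" for B
  have "inj_on cut (Pow (?V - {?v0}))"
  proof (rule inj_onI)
    fix B1 B2 assume B: "B1 \<in> Pow (?V - {?v0})" "B2 \<in> Pow (?V - {?v0})" and eq: "cut B1 = cut B2"
    define P where "P v \<longleftrightarrow> (v \<in> B1 \<longleftrightarrow> v \<in> B2)" for v
    have uncut: "P (take l e) = P (tl e)" if "e \<in> ?F" for e
    proof -
      have "e \<in> cut B1 \<longleftrightarrow> e \<in> cut B2" using eq by simp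
      then show ?thesis using that by (auto simp: cut_def P_def)
    qed
    \<comment> \<open>Whether exactly one of \<open>B1\<close>, \<open>B2\<close> contains a vertex does not change along a circuit of \<open>A\<close>.\<close>
    have circ: "P (fac X t l) = P (fac X (t + 1) l)" if "X \<in> A" for X t
      using that
    proof (induction "min_period X" arbitrary: X t rule: less_induct)
      case less
      let ?m = "min_period X"
      have edge: "P (fac X t l) = P (fac X (t + 1) l)" if ne: "fac X t (Suc l) \<noteq> piv X" for t
      proof (cases "fac X t (Suc l) \<in> piv ` A")
        case False
        then have "fac X t (Suc l) \<in> ?F" using sub[OF less.prems] by auto
        from uncut[OF this] show ?thesis by (simp add: take_fac tl_fac)
      next
        case True
        then obtain Y where Y: "Y \<in> A" "fac X t (Suc l) = piv Y" by auto
        then have "piv Y \<in> facs X (Suc l)" by (metis fac_in_facs)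
        then have "\<not> min_period X \<le> min_period Y" using piv_other[OF Y(1) less.prems] Y ne by auto
        then have "min_period Y < min_period X" by simp
        then have "P (fac Y (pos Y) l) = P (fac Y (pos Y + 1) l)" using less.hyps Y(1) by blast
        moreover have "fac X t (Suc l) = fac Y (pos Y) (Suc l)" using Y by (simp add: piv_def)
        ultimately show ?thesis by (simp only: fac_SucD[of X t l Y "pos Y"])
      qed
      have m0: "0 < ?m" using has_period_pos[OF has_period[OF less.prems]] .
      \<comment> \<open>Go round the circuit from the end of the pivot edge back to its start.\<close>
      have around: "P (fac X (pos X + 1) l) = P (fac X (pos X + 1 + int s) l)" if "s < ?m" for s
        using that
      proof (induction s)
        case (Suc s)
        have "fac X (pos X + 1 + int s) (Suc l) \<noteq> piv X"
        proof
          assume "fac X (pos X + 1 + int s) (Suc l) = piv X"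
          then have "int ?m dvd (pos X + 1 + int s) - pos X"
            using le[OF less.prems] unfolding piv_def
            by (intro min_period_dvd_diff[OF has_period[OF less.prems], where L = "Suc l"]) auto
          then have "int ?m dvd int (Suc s)" by simp
          then show False using Suc.prems by (auto simp only: int_dvd_int_iff dest: dvd_imp_le)
        qed
        from edge[OF this] Suc show ?case by (simp add: algebra_simps)
      qed simp
      have "fac X (pos X + 1 + int (?m - 1)) l = fac X (pos X) l"
        unfolding fac_eq_iff
        by (intro allI impI has_period_cong[OF has_period[OF less.prems]]) (use m0 in \<open>simp add: of_nat_diff mod_eq_dvd_iff\<close>)
      then have piv_edge: "P (fac X (pos X) l) = P (fac X (pos X + 1) l)"
        using around[of "?m - 1"] m0 by simp
      show ?case
      proof (cases "fac X t (Suc l) = piv X")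
        case True
        then have "fac X t (Suc l) = fac X (pos X) (Suc l)" by (simp add: piv_def)
        then have "fac X t l = fac X (pos X) l" "fac X (t + 1) l = fac X (pos X + 1) l"
          by (rule fac_SucD)+
        then show ?thesis using piv_edge by simp
      qed (rule edge)
    qed
    have edges: "P (fac W t l) = P (fac W (t + 1) l)" for t
    proof (cases "fac W t (Suc l) \<in> piv ` A")
      case False
      then have "fac W t (Suc l) \<in> ?F" by auto
      from uncut[OF this] show ?thesis by (simp add: take_fac tl_fac)
    next
      case True
      then obtain Y where Y: "Y \<in> A" "fac W t (Suc l) = fac Y (pos Y) (Suc l)" by (auto simp: piv_def)
      then show ?thesis using circ[OF Y(1)] by (simp only: fac_SucD[of W t l Y "pos Y"])
    qed
    have P0: "P ?v0" using B by (auto simp: P_def)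
    have "P (fac W t l)" for t
    proof (induction t rule: int_induct[where k = 0])
      case base then show ?case using P0 .
    next
      case (step1 i) then show ?case using edges[of i] by simp
    next
      case (step2 i) then show ?case using edges[of "i - 1"] by simp
    qed
    then have "P v" if "v \<in> ?V" for v using that by (auto simp: facs_def)
    then show "B1 = B2" using B by (auto simp: P_def)
  qed
  moreover have "cut ` Pow (?V - {?v0}) \<subseteq> Pow ?F" by (auto simp: cut_def)
  ultimately have "card (Pow (?V - {?v0})) \<le> card (Pow ?F)"
    using finE by (intro card_inj_on_le) auto
  then have "card (?V - {?v0}) \<le> card ?F" using finV finE by (simp add: card_Pow)
  moreover have "card (?V - {?v0}) = card ?V - 1" using finV by simp
  moreover have "card ?F = card ?E - card (piv ` A)"
    using pivE A by (intro card_Diff_subset) auto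
  then have "card ?F = card ?E - card A" by (simp add: card_image[OF inj_piv])
  moreover have "card A \<le> card ?E"
    using pivE finE by (subst card_image[OF inj_piv, symmetric]) (auto intro: card_mono)
  ultimately show ?thesis by linarith
qed

text \<open>If only the vertex \<open>fac X i l\<close> branches and \<open>W\<close> leaves it along \<open>X\<close>, then \<open>W\<close> runs through the
  whole circuit and comes back to that vertex.\<close>

lemma loop:
  assumes X: "has_period X (min_period X)" and le: "min_period X \<le> l"
    and sub: "facs X (Suc l) \<subseteq> facs W (Suc l)"
    and start: "fac W j (Suc l) = fac X i (Suc l)"
    and uniq: "\<And>e e'. e \<in> facs W (Suc l) \<Longrightarrow> e' \<in> facs W (Suc l) \<Longrightarrow> take l e = take l e'
       \<Longrightarrow> take l e \<noteq> fac X i l \<Longrightarrow> e = e'"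
  shows "fac W j (l + min_period X) = fac X i (l + min_period X)" (is ?A)
    and "fac W (j + int (min_period X)) l = fac X i l" (is ?B)
proof -
  let ?m = "min_period X"
  have m0: "0 < ?m" using has_period_pos[OF X] .
  have "fac W (j + 1) l = fac X (i + 1) l" using start by (rule fac_SucD)
  then have A1: "fac W (j + 1) (l + (?m - 1)) = fac X (i + 1) (l + (?m - 1))"
  proof (rule follow)
    fix t e assume t: "t < ?m - 1" and e: "e \<in> facs W (Suc l)" "take l e = fac X (i + 1 + int t) l"
    have ne: "fac X (i + 1 + int t) l \<noteq> fac X i l"
    proof
      assume "fac X (i + 1 + int t) l = fac X i l"
      then have "int ?m dvd (i + 1 + int t) - i" using le by (intro min_period_dvd_diff[OF X]) auto
      then have "int ?m dvd int (Suc t)" by simp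
      then show False using t by (auto simp only: int_dvd_int_iff dest: dvd_imp_le)
    qed
    show "e = fac X (i + 1 + int t) (Suc l)"
    proof (rule uniq[OF e(1)])
      show "fac X (i + 1 + int t) (Suc l) \<in> facs W (Suc l)" using sub by blast
    qed (use e ne in \<open>simp_all add: take_fac\<close>)
  qed
  have agree: "W (j + int t) = X (i + int t)" if "t < l + ?m" for t
  proof (cases t)
    case 0
    then show ?thesis using start unfolding fac_eq_iff by auto
  next
    case (Suc s)
    then have "W (j + 1 + int s) = X (i + 1 + int s)" using A1 that m0 unfolding fac_eq_iff by simp
    then show ?thesis using Suc by (simp add: algebra_simps)
  qed
  then show ?A unfolding fac_eq_iff by blast
  show ?B unfolding fac_eq_iff
  proof (intro allI impI)
    fix t assume "t < l"
    then have "W (j + int (?m + t)) = X (i + int (?m + t))" by (intro agree) simp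
    also have "\<dots> = X (i + int t)" by (rule has_period_cong[OF X]) (simp add: mod_eq_dvd_iff)
    finally show "W (j + int ?m + int t) = X (i + int t)" by (simp add: algebra_simps)
  qed
qed

lemma loop_twice:
  assumes X: "has_period X p"
    and A: "fac W j (l + p) = fac X i (l + p)"
    and B: "fac W (j + int p) (l + p) = fac X i (l + p)"
  shows "facs X (Suc l + p) \<subseteq> facs W (Suc l + p)"
proof (rule facs_window[OF X])
  show "fac W j (l + p + p) = fac X i (l + p + p)"
    unfolding fac_eq_iff
  proof (intro allI impI)
    fix t assume t: "t < l + p + p"
    show "W (j + int t) = X (i + int t)"
    proof (cases "t < p")
      case True
      then show ?thesis using A unfolding fac_eq_iff by simp
    next
      case False
      then obtain s where s: "t = p + s" using le_Suc_ex not_less by blast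
      then have "W (j + int p + int s) = X (i + int s)" using B t unfolding fac_eq_iff by simp
      also have "\<dots> = X (i + int t)" by (rule has_period_cong[OF X]) (simp add: s mod_eq_dvd_iff)
      finally show ?thesis by (simp add: s algebra_simps)
    qed
  qed
  show "Suc l + p + p \<le> Suc (l + p + p)" by simp
qed

text \<open>If \<open>C(l + 1) = C(l) + 1\<close>, only one vertex \<open>z\<close> branches, and it has no more than two outgoing
  edges.\<close>

lemma single_branching:
  assumes W: "has_period W n" and card: "card (facs W (Suc l)) = Suc (card (facs W l))"
  shows "\<exists>z e1 e2. (\<forall>d\<in>facs W (Suc l). take l d = z \<longrightarrow> d \<in> {e1, e2}) \<and>
    (\<forall>d\<in>facs W (Suc l). \<forall>d'\<in>facs W (Suc l). take l d = take l d' \<longrightarrow> take l d \<noteq> z \<longrightarrow> d = d')"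
proof -
  let ?E = "facs W (Suc l)"
  have fin: "finite ?E" using finite_facs(1)[OF W] .
  have "\<not> inj_on (take l) ?E"
    using card card_image[of "take l" ?E] by (auto simp: take_image_facs)
  then obtain e1 e2 where e: "e1 \<in> ?E" "e2 \<in> ?E" "e1 \<noteq> e2" "take l e1 = take l e2"
    by (auto simp: inj_on_def)
  define z where "z = take l e1"
  have inj: "inj_on (take l) (?E - {e'})" if "e' \<in> {e1, e2}" for e'
  proof -
    have "take l ` (?E - {e'}) = facs W l"
    proof
      show "facs W l \<subseteq> take l ` (?E - {e'})"
      proof
        fix v assume "v \<in> facs W l"
        then obtain d where d: "d \<in> ?E" "v = take l d" using take_image_facs[of l W] by auto
        show "v \<in> take l ` (?E - {e'})"
        proof (cases "d = e'")
          case True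
          then have "v = take l e1" "v = take l e2" using that e d by auto
          then show ?thesis using that e by blast
        qed (use d in auto)
      qed
    qed (use take_image_facs[of l W] in auto)
    moreover have "card (?E - {e'}) = card (facs W l)" using that e fin card by auto
    ultimately show ?thesis using fin by (intro eq_card_imp_inj_on) auto
  qed
  have zz: "d \<in> {e1, e2}" if "d \<in> ?E" "take l d = z" for d
    using inj_onD[OF inj[of e1], of d e2] that e by (auto simp: z_def)
  have uniq: "d = d'" if "d \<in> ?E" "d' \<in> ?E" "take l d = take l d'" "take l d \<noteq> z" for d d'
  proof -
    have "d \<noteq> e1" "d' \<noteq> e1" using that by (auto simp: z_def)
    then show ?thesis using inj_onD[OF inj[of e1], of d d'] that by simp
  qed
  show ?thesis using zz uniq by blast
qed

lemma circuit_visits_branching: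
  assumes W: "has_period W n" and U: "has_period U m"
    and uniq: "\<And>d d'. d \<in> facs W (Suc l) \<Longrightarrow> d' \<in> facs W (Suc l) \<Longrightarrow> take l d = take l d'
           \<Longrightarrow> take l d \<noteq> z \<Longrightarrow> d = d'"
    and s: "facs U (Suc l) \<subseteq> facs W (Suc l)" and n: "\<not> shift_eq W U"
  shows "\<exists>i. fac U i l = z"
proof (rule ccontr)
  assume none: "\<nexists>i. fac U i l = z"
  have "shift_eq W U"
  proof (rule unbranched_circuit[OF W U s])
    fix t d assume "d \<in> facs W (Suc l)" "take l d = fac U t l"
    moreover have "fac U t (Suc l) \<in> facs W (Suc l)" using s by blast
    moreover have "fac U t l \<noteq> z" using none by blast
    ultimately show "d = fac U t (Suc l)" by (intro uniq[of d "fac U t (Suc l)"]) (simp_all add: take_fac)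
  qed
  then show False using n by simp
qed

lemma common_vertex:
  assumes W: "has_period W n" and X: "has_period X m" and Y: "has_period Y m'"
    and "facs X (Suc l) \<subseteq> facs W (Suc l)" "facs Y (Suc l) \<subseteq> facs W (Suc l)"
    and "\<not> shift_eq W X" "\<not> shift_eq W Y"
    and card: "card (facs W (Suc l)) = Suc (card (facs W l))"
  shows "\<exists>i k. fac X i l = fac Y k l"
proof -
  obtain z e1 e2
    where "\<forall>d\<in>facs W (Suc l). take l d = z \<longrightarrow> d \<in> {e1, e2}"
      and uniq: "\<forall>d\<in>facs W (Suc l). \<forall>d'\<in>facs W (Suc l). take l d = take l d' \<longrightarrow> take l d \<noteq> z \<longrightarrow> d = d'"
    using single_branching[OF W card] by (elim exE conjE) (rule that)
  obtain i where "fac X i l = z" using circuit_visits_branching[OF W X uniq[rule_format]] assms(4,6) by blast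
  moreover obtain k where "fac Y k l = z" using circuit_visits_branching[OF W Y uniq[rule_format]] assms(5,7) by blast
  ultimately show ?thesis by metis
qed

text \<open>At an order with \<open>C(l + 1) = C(l) + 1\<close>, two distinct circuits both pass through the branching
  vertex and leave it along different edges. Hence \<open>W\<close> is a concatenation of the two loops. It takes
  one of them twice in a row, for otherwise the two would alternate and \<open>W\<close> would have period
  \<open>min_period X + min_period Y\<close>, which is less than its least period.\<close>

lemma two_circuits:
  assumes W: "has_period W (min_period W)" and X: "has_period X (min_period X)" and Y: "has_period Y (min_period Y)"
    and lX: "min_period X \<le> l" and lY: "min_period Y \<le> l"
    and sX: "facs X (Suc l) \<subseteq> facs W (Suc l)" and sY: "facs Y (Suc l) \<subseteq> facs W (Suc l)"
    and XY: "\<not> shift_eq X Y" and WX: "\<not> shift_eq W X" and WY: "\<not> shift_eq W Y"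
    and small: "min_period X + min_period Y < min_period W"
    and card: "card (facs W (Suc l)) = Suc (card (facs W l))"
  shows "facs X (Suc l + min_period X) \<subseteq> facs W (Suc l + min_period X) \<or> facs Y (Suc l + min_period Y) \<subseteq> facs W (Suc l + min_period Y)"
proof -
  let ?E = "facs W (Suc l)"
  obtain z e1 e2
    where zz': "\<forall>d\<in>?E. take l d = z \<longrightarrow> d \<in> {e1, e2}"
      and uniq': "\<forall>d\<in>?E. \<forall>d'\<in>?E. take l d = take l d' \<longrightarrow> take l d \<noteq> z \<longrightarrow> d = d'"
    using single_branching[OF W card] by (elim exE conjE) (rule that)
  note zz = zz'[rule_format] and uniq = uniq'[rule_format]
  obtain i where i: "fac X i l = z" using circuit_visits_branching[OF W X uniq sX WX] by blast
  obtain k where k: "fac Y k l = z" using circuit_visits_branching[OF W Y uniq sY WY] by blast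
  define x where "x = fac X i (Suc l)"
  define y where "y = fac Y k (Suc l)"
  have x: "x \<in> ?E" "take l x = z" using sX i by (auto simp: x_def take_fac)
  have y: "y \<in> ?E" "take l y = z" using sY k by (auto simp: y_def take_fac)
  have again: "fac U t (Suc l) = fac U i' (Suc l)"
    if "has_period U (min_period U)" "min_period U \<le> l" "fac U t l = fac U i' l" for U :: "int \<Rightarrow> 'a" and t i'
  proof -
    have "int (min_period U) dvd t - i'" using that by (intro min_period_dvd_diff) auto
    then have "U (t + s) = U (i' + s)" for s
      by (intro has_period_cong[OF that(1)]) (simp add: mod_eq_dvd_iff)
    then show ?thesis unfolding fac_eq_iff by simp
  qed
  have "x \<noteq> y"
  proof
    assume xy: "x = y"
    have "fac Y k (l + (min_period X + min_period Y)) = fac X i (l + (min_period X + min_period Y))"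
    proof (rule follow)
      show "fac Y k l = fac X i l" using i k by simp
      fix t d assume d: "d \<in> facs Y (Suc l)" "take l d = fac X (i + int t) l"
      show "d = fac X (i + int t) (Suc l)"
      proof (cases "fac X (i + int t) l = z")
        case True
        then have "fac X (i + int t) l = fac X i l" using i by simp
        then have "fac X (i + int t) (Suc l) = x" unfolding x_def by (rule again[OF X lX])
        moreover obtain k' where k': "d = fac Y k' (Suc l)" using d by (auto simp: facs_def)
        have "fac Y k' l = fac Y k l" using d True k by (simp add: k' take_fac)
        then have "d = y" unfolding y_def k' by (rule again[OF Y lY])
        ultimately show ?thesis using xy by simp
      next
        case False
        moreover have "d \<in> ?E" using d sY by blast
        moreover have "fac X (i + int t) (Suc l) \<in> ?E" using sX by blast
        ultimately show ?thesis using d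
          by (intro uniq[of d "fac X (i + int t) (Suc l)"]) (simp_all add: take_fac)
      qed
    qed
    then have "X (i + int t) = Y (k + int t)" if "t < min_period X + min_period Y" for t
      using that unfolding fac_eq_iff by simp
    then have "X (i + c) = Y (k + c)" for c by (rule fine_wilf[OF X Y])
    then show False using XY shift_eqI by blast
  qed
  then have xy: "d = x \<or> d = y" if "d \<in> ?E" "take l d = z" for d
    using zz[OF that] zz[OF x] zz[OF y] by auto
  have loopX: "fac W j (l + min_period X) = fac X i (l + min_period X)" "fac W (j + int (min_period X)) l = z"
    if "fac W j (Suc l) = x" for j
    using loop[OF X lX sX, of j i] that uniq i by (auto simp: x_def)
  have loopY: "fac W j (l + min_period Y) = fac Y k (l + min_period Y)" "fac W (j + int (min_period Y)) l = z"
    if "fac W j (Suc l) = y" for j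
    using loop[OF Y lY sY, of j k] that uniq k by (auto simp: y_def)
  consider (xx) j where "fac W j (Suc l) = x" "fac W (j + int (min_period X)) (Suc l) = x"
    | (yy) j where "fac W j (Suc l) = y" "fac W (j + int (min_period Y)) (Suc l) = y"
    | (alt) "\<And>j. fac W j (Suc l) = x \<Longrightarrow> fac W (j + int (min_period X)) (Suc l) \<noteq> x"
            "\<And>j. fac W j (Suc l) = y \<Longrightarrow> fac W (j + int (min_period Y)) (Suc l) \<noteq> y"
    by blast
  then show ?thesis
  proof cases
    case xx
    then show ?thesis using loop_twice[OF X] loopX by blast
  next
    case yy
    then show ?thesis using loop_twice[OF Y] loopY by blast
  next
    case alt
    let ?D = "min_period X + min_period Y"
    have nextX: "fac W (j + int (min_period X)) (Suc l) = y" if "fac W j (Suc l) = x" for j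
      using xy[of "fac W (j + int (min_period X)) (Suc l)"] alt(1)[OF that] loopX(2)[OF that] by (simp add: take_fac)
    have nextY: "fac W (j + int (min_period Y)) (Suc l) = x" if "fac W j (Suc l) = y" for j
      using xy[of "fac W (j + int (min_period Y)) (Suc l)"] alt(2)[OF that] loopY(2)[OF that] by (simp add: take_fac)
    have nextD: "fac W (j + int ?D) (Suc l) = x" if "fac W j (Suc l) = x" for j
      using nextY[OF nextX[OF that]] by (simp add: algebra_simps)
    obtain j0 where j0: "fac W j0 (Suc l) = x" using x by (auto simp: facs_def)
    have js: "fac W (j0 + int (s * ?D)) (Suc l) = x" for s
    proof (induction s)
      case (Suc s)
      from nextD[OF this] show ?case by (simp add: algebra_simps)
    qed (use j0 in simp)
    have block: "W (j + int t) = (if t < min_period X then X (i + int t) else Y (k + int (t - min_period X)))"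
      if j: "fac W j (Suc l) = x" and t: "t < ?D" for j t
    proof (cases "t < min_period X")
      case True
      then show ?thesis using loopX(1)[OF j] unfolding fac_eq_iff by simp
    next
      case False
      have "W (j + int t) = W (j + int (min_period X) + int (t - min_period X))" using False by simp
      also have "\<dots> = Y (k + int (t - min_period X))"
        using False t by (intro fac_eqD[OF loopY(1)[OF nextX[OF j]]]) simp
      finally show ?thesis using False by simp
    qed
    have "W (j0 + int ?D + int t) = W (j0 + int t)" for t
    proof -
      define s where "s = t div ?D"
      define r where "r = t mod ?D"
      have D0: "0 < ?D" using has_period_pos[OF X] by simp
      have r: "r < ?D" using D0 by (simp add: r_def)
      have t: "t = s * ?D + r" by (simp only: s_def r_def div_mult_mod_eq)
      have "W (j0 + int (Suc s * ?D) + int r) = W (j0 + int (s * ?D) + int r)"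
        by (simp only: block[OF js r])
      moreover have "j0 + int (Suc s * ?D) + int r = j0 + int ?D + int t"
        by (simp add: t algebra_simps)
      moreover have "j0 + int (s * ?D) + int r = j0 + int t" by (simp add: t)
      ultimately show ?thesis by metis
    qed
    then have "W (j0 + int ?D + c) = W (j0 + c)" for c
      by (rule has_period_agreeI[OF W W])
    then have "W (j0 + int ?D + (c - j0)) = W (j0 + (c - j0))" for c .
    then have "W (c + int ?D) = W c" for c by (simp add: algebra_simps)
    then have "has_period W ?D" using has_period_pos[OF X] by (simp add: has_period_def)
    then show ?thesis using min_period_le[of W ?D] small by simp
  qed
qed

section \<open>The squares of one conjugacy class\<close>

text \<open>The squares of length at most \<open>N\<close> in \<open>W\<close> whose primitive root is a conjugate of the period word
  of \<open>X\<close>, that is a factor of \<open>X\<close> of length \<open>min_period X\<close>. The square of the \<open>k\<close>-th power of the root has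
  length \<open>2 * k * min_period X\<close>.\<close>

definition class_squares :: "(int \<Rightarrow> 'a) \<Rightarrow> nat \<Rightarrow> (int \<Rightarrow> 'a) \<Rightarrow> 'a list set" where
  "class_squares W N X =
    {fac X i (2 * k * min_period X) |i k. 0 < k \<and> 2 * k * min_period X \<le> N \<and> fac X i (2 * k * min_period X) \<in> facs W (2 * k * min_period X)}"

lemma class_squaresI:
  assumes "0 < k" "2 * k * min_period X \<le> N" "z = fac X i (2 * k * min_period X)" "z \<in> facs W (2 * k * min_period X)"
  shows "z \<in> class_squares W N X"
  using assms unfolding class_squares_def by blast

lemma fac_mod: assumes "has_period X p" shows "fac X i L = fac X (int (nat (i mod int p))) L"
  unfolding fac_eq_iff
proof (intro allI impI has_period_cong[OF assms])
  have "0 < int p" using has_period_pos[OF assms] by simp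
  then show "(i + int t) mod int p = (int (nat (i mod int p)) + int t) mod int p" for t
    by (simp add: mod_simps)
qed

text \<open>The factors of \<open>X\<close> of length \<open>L\<close> all occur in \<open>W\<close> exactly up to some bound on \<open>L\<close>; by Fine and Wilf
  the bound is less than the sum of the periods.\<close>

lemma maximal_level:
  assumes W: "has_period W n" and X: "has_period X m" and ne: "\<not> shift_eq W X"
  shows "\<exists>lam. \<forall>L. facs X L \<subseteq> facs W L \<longleftrightarrow> L \<le> lam"
proof -
  let ?P = "\<lambda>L. facs X L \<subseteq> facs W L"
  have bound: "L < n + m" if L: "?P L" for L
  proof (rule ccontr)
    assume "\<not> L < n + m"
    moreover have "fac X 0 L \<in> facs W L" using L fac_in_facs by (rule subsetD)
    then obtain j where j: "fac W j L = fac X 0 L" by (auto simp: facs_def)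
    ultimately have "W (j + int t) = X (0 + int t)" if "t < n + m" for t
      using that by (intro fac_eqD[OF j]) simp
    then have "W (j + k) = X (0 + k)" for k by (rule fine_wilf[OF W X])
    then show False using ne shift_eqI by blast
  qed
  have fin: "finite {L. ?P L}" by (rule finite_subset[of _ "{..<n + m}"]) (use bound in auto)
  have zero: "?P 0" by (auto simp: facs_def fac_def)
  show ?thesis
  proof (intro exI allI)
    fix L
    show "?P L \<longleftrightarrow> L \<le> Max {L. ?P L}"
    proof
      assume "?P L"
      then show "L \<le> Max {L. ?P L}" using fin by (intro Max_ge) auto
    next
      assume "L \<le> Max {L. ?P L}"
      moreover have "?P (Max {L. ?P L})" using Max_in[OF fin] zero by blast
      ultimately show "?P L" by (metis facs_mono)
    qed
  qed
qed

text \<open>If \<open>r\<close> of the \<open>m\<close> factors of \<open>X\<close> of length \<open>N\<close> occur in \<open>W\<close>, then all its factors of length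
  \<open>N - m + r\<close> do: among \<open>m - r + 1\<close> consecutive residues modulo \<open>m\<close> there is the starting position of
  an occurring one.\<close>

lemma long_factors:
  assumes X: "has_period X m" and r: "r = card {t. t < m \<and> fac X (int t) N \<in> facs W N}" and r0: "0 < r"
    and L: "L + m \<le> N + r"
  shows "facs X L \<subseteq> facs W L"
proof
  let ?R = "{t. t < m \<and> fac X (int t) N \<in> facs W N}"
  fix x assume "x \<in> facs X L"
  then obtain a where a: "x = fac X a L" by (auto simp: facs_def)
  have m0: "0 < int m" using has_period_pos[OF X] by simp
  have "card ?R \<le> card {..<m}" by (intro card_mono) auto
  then have rm: "r \<le> m" using r by simp
  define f where "f d = nat ((a - int d) mod int m)" for d
  have f: "f d < m" "int (f d) = (a - int d) mod int m" for d
    using m0 by (auto simp: f_def nat_less_iff)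
  have inj: "inj_on f {..m - r}"
  proof (rule inj_onI)
    fix d d' assume d: "d \<in> {..m - r}" "d' \<in> {..m - r}" "f d = f d'"
    then have "(a - int d) mod int m = (a - int d') mod int m" using f(2) by metis
    then have "int m dvd int d' - int d" by (simp add: mod_eq_dvd_iff)
    moreover have "\<bar>int d' - int d\<bar> < int m" using d r0 rm by auto
    ultimately have "int d' - int d = 0"
      using dvd_imp_le_int[of "int d' - int d" "int m"] by fastforce
    then show "d = d'" by simp
  qed
  have "f ` {..m - r} \<inter> ?R \<noteq> {}"
  proof
    assume dis: "f ` {..m - r} \<inter> ?R = {}"
    have "card (f ` {..m - r} \<union> ?R) \<le> card {..<m}" using f by (intro card_mono) auto
    moreover have "card (f ` {..m - r} \<union> ?R) = card (f ` {..m - r}) + card ?R"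
      using dis by (intro card_Un_disjoint) auto
    moreover have "card (f ` {..m - r}) = m - r + 1" using card_image[OF inj] by simp
    ultimately show False using r rm by simp
  qed
  then obtain d where d: "d \<le> m - r" "fac X (int (f d)) N \<in> facs W N" by auto
  then obtain j where j: "fac X (int (f d)) N = fac W j N" by (auto simp: facs_def)
  have "fac W (j + int d) L = x" unfolding a fac_eq_iff
  proof (intro allI impI)
    fix t assume "t < L"
    then have "X (int (f d) + int (d + t)) = W (j + int (d + t))"
      using d(1) L rm by (intro fac_eqD[OF j]) simp
    moreover have "X (int (f d) + int (d + t)) = X (a + int t)"
    proof (rule has_period_cong[OF X])
      have "int (f d) + int (d + t) - (a + int t) = int m * - ((a - int d) div int m)"
        by (simp add: f(2) minus_mult_div_eq_mod[symmetric])
      then show "(int (f d) + int (d + t)) mod int m = (a + int t) mod int m"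
        unfolding mod_eq_dvd_iff by (metis dvd_triv_left)
    qed
    ultimately show "W (j + int d + int t) = X (a + int t)" by (simp add: add.assoc)
  qed
  then show "x \<in> facs W L" by (metis fac_in_facs)
qed

text \<open>Here \<open>s = (k - 1) m + r\<close>, with \<open>k\<close> the largest exponent of a square and \<open>r\<close> the number of squares with
  that exponent, and \<open>lam \<ge> (2 k - 1) m + r\<close>.\<close>

lemma class_bounds:
  assumes W: "has_period W n" and X: "has_period X (min_period X)" and ne: "\<not> shift_eq W X"
    and sq: "class_squares W N X \<noteq> {}"
  shows "\<exists>s lam. (\<forall>L. facs X L \<subseteq> facs W L \<longleftrightarrow> L \<le> lam) \<and> card (class_squares W N X) \<le> s \<and>
    2 * s \<le> lam \<and> s + min_period X \<le> lam \<and> (min_period X < s \<longrightarrow> s + 2 * min_period X \<le> lam)"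
proof -
  let ?m = "min_period X"
  obtain lam where lam: "\<forall>L. facs X L \<subseteq> facs W L \<longleftrightarrow> L \<le> lam"
    using maximal_level[OF W X ne] by (rule exE)
  have m0: "0 < ?m" using has_period_pos[OF X] .
  let ?K = "{k. 0 < k \<and> 2 * k * ?m \<le> N \<and> (\<exists>i. fac X i (2 * k * ?m) \<in> facs W (2 * k * ?m))}"
  have "k \<le> N" if "2 * k * ?m \<le> N" for k
  proof -
    have "k * 1 \<le> k * (2 * ?m)" by (intro mult_le_mono2) (use m0 in simp)
    also have "k * (2 * ?m) = 2 * k * ?m" by simp
    also note that
    finally show ?thesis by simp
  qed
  then have finK: "finite ?K" by (intro finite_subset[of ?K "{..N}"]) auto
  have "?K \<noteq> {}" using sq unfolding class_squares_def by blast
  define k where "k = Max ?K"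
  have kK: "k \<in> ?K" unfolding k_def using finK \<open>?K \<noteq> {}\<close> by (rule Max_in)
  have kmax: "k' \<le> k" if "k' \<in> ?K" for k' unfolding k_def using finK that by (rule Max_ge)
  let ?R = "{t. t < ?m \<and> fac X (int t) (2 * k * ?m) \<in> facs W (2 * k * ?m)}"
  define r where "r = card ?R"
  have t_less: "nat (i mod int ?m) < ?m" for i using m0 by (simp add: nat_less_iff)
  obtain i where "fac X i (2 * k * ?m) \<in> facs W (2 * k * ?m)" using kK by blast
  then have "nat (i mod int ?m) \<in> ?R" using fac_mod[OF X, of i] t_less by simp
  then have r0: "0 < r" unfolding r_def by (subst card_gt_0_iff) auto
  have "card ?R \<le> card {..<?m}" by (intro card_mono) auto
  then have rm: "r \<le> ?m" by (simp add: r_def)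
  obtain c where c: "k = Suc c" using kK by (cases k) auto
  define s where "s = c * ?m + r"
  have "class_squares W N X \<subseteq> (\<lambda>(k', t). fac X (int t) (2 * k' * ?m)) ` ({1..c} \<times> {..<?m})
      \<union> (\<lambda>t. fac X (int t) (2 * k * ?m)) ` ?R" (is "_ \<subseteq> ?A \<union> ?B")
  proof
    fix z assume "z \<in> class_squares W N X"
    then obtain i k' where z: "z = fac X i (2 * k' * ?m)" "0 < k'" "2 * k' * ?m \<le> N" "z \<in> facs W (2 * k' * ?m)"
      unfolding class_squares_def by blast
    let ?t = "nat (i mod int ?m)"
    have zt: "z = fac X (int ?t) (2 * k' * ?m)" using z(1) fac_mod[OF X] by simp
    have "k' \<le> k" using z by (intro kmax) auto
    show "z \<in> ?A \<union> ?B"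
    proof (cases "k' = k")
      case True
      have "?t \<in> ?R" using zt z(4) t_less True by blast
      then have "fac X (int ?t) (2 * k * ?m) \<in> ?B" by (rule imageI)
      then show ?thesis using zt True by simp
    next
      case False
      then have "(k', ?t) \<in> {1..c} \<times> {..<?m}" using \<open>k' \<le> k\<close> z(2) c t_less by simp
      then have "(\<lambda>(k', t). fac X (int t) (2 * k' * ?m)) (k', ?t) \<in> ?A" by (rule imageI)
      then show ?thesis using zt by simp
    qed
  qed
  then have "card (class_squares W N X) \<le> card (?A \<union> ?B)" by (intro card_mono) auto
  also have "\<dots> \<le> card ?A + card ?B" by (rule card_Un_le)
  also have "\<dots> \<le> c * ?m + r"
    using card_image_le[of "{1..c} \<times> {..<?m}" "\<lambda>(k', t). fac X (int t) (2 * k' * ?m)"]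
      card_image_le[of ?R "\<lambda>t. fac X (int t) (2 * k * ?m)"] by (simp add: r_def)
  finally have card: "card (class_squares W N X) \<le> s" by (simp add: s_def)
  have "facs X (2 * (c * ?m) + ?m + r) \<subseteq> facs W (2 * (c * ?m) + ?m + r)"
    using r0 by (intro long_factors[OF X, of r "2 * k * ?m"]) (simp_all add: r_def c algebra_simps)
  then have long: "2 * (c * ?m) + ?m + r \<le> lam" using lam by blast
  have "?m \<le> c * ?m" if "?m < s"
    using that rm by (cases c) (auto simp: s_def)
  then have "?m < s \<longrightarrow> s + 2 * ?m \<le> lam" using long unfolding s_def by linarith
  moreover have "2 * s \<le> lam" "s + ?m \<le> lam" using long rm by (auto simp: s_def)
  ultimately show ?thesis using lam card by blast
qed

section \<open>Charging squares to orders of the Rauzy graph\<close>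

lemma sum_increments: "(\<Sum>l<N. card (facs W (Suc l)) - card (facs W l)) \<le> min_period W - 1"
  if W: "has_period W (min_period W)" for N
proof -
  have "(\<Sum>l<N. card (facs W (Suc l)) - card (facs W l)) + 1 = card (facs W N)"
  proof (induction N)
    case 0
    have "facs W 0 = {[]}" by (auto simp: facs_def fac_def)
    then show ?case by simp
  next
    case (Suc N)
    then show ?case using card_facs_mono[OF W, of N] by simp
  qed
  then show ?thesis using finite_facs(2)[OF W, of N] by simp
qed

text \<open>A family of pairwise inequivalent conjugacy classes, each with the bounds of \<open>class_bounds\<close>: \<open>s X\<close>
  bounds the number of squares of \<open>X\<close>, and \<open>lam X\<close> is the largest length for which all factors of
  \<open>X\<close> occur in \<open>W\<close>.\<close>

locale circuit_family =
  fixes W :: "int \<Rightarrow> 'a" and T :: "(int \<Rightarrow> 'a) set" and s lam :: "(int \<Rightarrow> 'a) \<Rightarrow> nat"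
  assumes W: "has_period W (min_period W)" and finT: "finite T"
    and perT: "X \<in> T \<Longrightarrow> has_period X (min_period X)"
    and ne: "X \<in> T \<Longrightarrow> \<not> shift_eq W X"
    and inequiv: "X \<in> T \<Longrightarrow> Y \<in> T \<Longrightarrow> shift_eq X Y \<Longrightarrow> X = Y"
    and lam: "X \<in> T \<Longrightarrow> facs X L \<subseteq> facs W L \<longleftrightarrow> L \<le> lam X"
    and s1: "X \<in> T \<Longrightarrow> 2 * s X \<le> lam X"
    and s2: "X \<in> T \<Longrightarrow> s X + min_period X \<le> lam X"
    and s3: "X \<in> T \<Longrightarrow> min_period X < s X \<Longrightarrow> s X + 2 * min_period X \<le> lam X"
begin

text \<open>At order \<open>l\<close>: the classes that are circuits of the Rauzy graph, those that have a square charged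
  to this order (each class uses the \<open>s X\<close> topmost orders at which it is available), and the number
  of edges minus the number of vertices. From order \<open>height\<close> on, no class is available.\<close>

definition "available l = {X \<in> T. min_period X \<le> l \<and> Suc l \<le> lam X}"
definition "used l = {X \<in> T. lam X - s X \<le> l \<and> Suc l \<le> lam X}"
definition "growth l = card (facs W (Suc l)) - card (facs W l)"
definition "height = Suc (Max (insert 0 (lam ` T)))"

lemma lam_less_height: "X \<in> T \<Longrightarrow> lam X < height"
  using finT by (auto simp: height_def less_Suc_eq_le intro!: Max_ge)

lemma used_subset: "used l \<subseteq> available l"
  unfolding available_def used_def using s2 by fastforce

lemma fin [simp]: "finite (available l)" "finite (used l)"
  using finT by (simp_all add: available_def used_def)

lemma card_available: "card (available l) \<le> growth l + 1"
proof -
  have "card (available l) + card (facs W l) \<le> card (facs W (Suc l)) + 1"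
    using perT inequiv lam finT by (intro circuits_independent[OF W]) (auto simp: available_def)
  then show ?thesis by (simp add: growth_def)
qed

lemma available_empty: assumes "growth l = 0" shows "available l = {}"
proof (rule ccontr)
  assume "available l \<noteq> {}"
  then obtain X where X: "X \<in> T" "Suc l \<le> lam X" by (auto simp: available_def)
  have "shift_eq W X"
    using unbranched_level[OF W perT[OF X(1)]] X lam assms by (simp add: growth_def)
  then show False using ne X by blast
qed

lemma card_used: "card (used l) \<le> growth l + 1" "growth l = 0 \<Longrightarrow> card (used l) = 0"
  using card_mono[OF _ used_subset, of l] card_available[of l] available_empty[of l] by auto

lemma sum_s: "(\<Sum>X\<in>T. s X) = (\<Sum>l<height. card (used l))"
proof -
  have "s X = (\<Sum>l<height. if X \<in> used l then 1 else 0)" if X: "X \<in> T" for X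
  proof -
    have "{l \<in> {..<height}. X \<in> used l} = {lam X - s X..<lam X}"
      using X lam_less_height[OF X] by (auto simp: used_def)
    then have "card {l \<in> {..<height}. X \<in> used l} = s X" using s1[OF X] by simp
    then show ?thesis by (simp add: sum.If_cases Int_def)
  qed
  then have "(\<Sum>X\<in>T. s X) = (\<Sum>X\<in>T. \<Sum>l<height. if X \<in> used l then 1 else 0)" by (rule sum.cong[OF refl])
  also have "\<dots> = (\<Sum>l<height. \<Sum>X\<in>T. if X \<in> used l then 1 else 0)" by (rule sum.swap)
  also have "\<dots> = (\<Sum>l<height. card (used l))"
  proof (rule sum.cong[OF refl])
    fix l
    have "used l = {X \<in> T. X \<in> used l}" by (auto simp: used_def)
    then show "(\<Sum>X\<in>T. if X \<in> used l then 1 else 0) = card (used l)"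
      using finT by (simp add: sum.If_cases Int_def)
  qed
  finally show ?thesis .
qed

lemma sum_growth: "(\<Sum>l<height. growth l) \<le> min_period W - 1"
  unfolding growth_def by (rule sum_increments[OF W])

lemma crude_bound: "(\<Sum>X\<in>T. s X) \<le> 2 * (min_period W - 1)"
proof -
  have "card (used l) \<le> 2 * growth l" for l using card_used[of l] by (cases "growth l = 0") auto
  then have "(\<Sum>l<height. card (used l)) \<le> (\<Sum>l<height. 2 * growth l)" by (intro sum_mono)
  also have "\<dots> \<le> 2 * (min_period W - 1)" using sum_growth by (simp add: sum_distrib_left[symmetric])
  finally show ?thesis by (simp add: sum_s)
qed

text \<open>A used class \<open>X\<close> with \<open>lam X \<ge> l + 1 + min_period X\<close> has \<open>s X > min_period X\<close>, so the last bound
  on \<open>s\<close> gives \<open>2 * min_period X \<le> l\<close>. Two such circuits that share a vertex are equal by Fine and Wilf.\<close>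

lemma no_two_long:
  assumes g: "growth l = 1" and X: "X \<in> used l" "Suc l + min_period X \<le> lam X"
    and Y: "Y \<in> used l" "Suc l + min_period Y \<le> lam Y"
  shows "X = Y"
proof -
  have small: "2 * min_period Z \<le> l" if Z: "Z \<in> used l" "Suc l + min_period Z \<le> lam Z" for Z
  proof -
    have ZT: "Z \<in> T" "lam Z - s Z \<le> l" using Z by (auto simp: used_def)
    then have "min_period Z < s Z" using Z by linarith
    from s3[OF ZT(1) this] show ?thesis using ZT by linarith
  qed
  have T: "X \<in> T" "Y \<in> T" using X Y by (auto simp: used_def)
  have card: "card (facs W (Suc l)) = Suc (card (facs W l))" using g by (simp add: growth_def)
  have "facs X (Suc l) \<subseteq> facs W (Suc l)" "facs Y (Suc l) \<subseteq> facs W (Suc l)"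
    using X Y lam T by auto
  then obtain i k where ik: "fac X i l = fac Y k l"
    using common_vertex[OF W perT[OF T(1)] perT[OF T(2)] _ _ ne[OF T(1)] ne[OF T(2)] card] by blast
  have "X (i + int t) = Y (k + int t)" if "t < min_period X + min_period Y" for t
    using that small[OF X] small[OF Y] by (intro fac_eqD[OF ik]) simp
  then have "X (i + c) = Y (k + c)" for c
    by (rule fine_wilf[OF perT[OF T(1)] perT[OF T(2)]])
  then have "shift_eq X Y" by (rule shift_eqI)
  then show ?thesis using inequiv T by blast
qed

lemma main_bound:
  assumes half: "\<And>X. X \<in> T \<Longrightarrow> 2 * min_period X < min_period W"
  shows "2 * (\<Sum>X\<in>T. s X) \<le> 3 * (min_period W - 1)"
proof -
  \<comment> \<open>the tight orders; \<open>c l\<close> is a loop that \<open>W\<close> takes twice in a row at the tight order \<open>l\<close>\<close>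
  define B where "B = {l \<in> {..<height}. growth l = 1 \<and> card (used l) = 2}"
  have "\<exists>c. c \<in> used l \<and> Suc l + min_period c \<le> lam c" if l: "l \<in> B" for l
  proof -
    obtain X Y where XY: "used l = {X, Y}" "X \<noteq> Y"
      using l unfolding B_def by (auto simp: card_2_iff)
    then have mem: "X \<in> used l" "Y \<in> used l" by auto
    then have T: "X \<in> T" "Y \<in> T" by (auto simp: used_def)
    have av: "X \<in> available l" "Y \<in> available l" using mem used_subset by auto
    then have le: "min_period X \<le> l" "min_period Y \<le> l" by (auto simp: available_def)
    have sub: "facs X (Suc l) \<subseteq> facs W (Suc l)" "facs Y (Suc l) \<subseteq> facs W (Suc l)"
      using av lam T by (auto simp: available_def)
    have card: "card (facs W (Suc l)) = Suc (card (facs W l))"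
    proof -
      have "growth l = 1" using l by (simp add: B_def)
      then show ?thesis unfolding growth_def by linarith
    qed
    have "\<not> shift_eq X Y" using inequiv T XY by blast
    moreover have "min_period X + min_period Y < min_period W" using half[OF T(1)] half[OF T(2)] by simp
    ultimately have "facs X (Suc l + min_period X) \<subseteq> facs W (Suc l + min_period X) \<or>
        facs Y (Suc l + min_period Y) \<subseteq> facs W (Suc l + min_period Y)"
      using two_circuits[OF W perT[OF T(1)] perT[OF T(2)] le sub _ ne[OF T(1)] ne[OF T(2)] _ card] by blast
    then show ?thesis using lam[OF T(1)] lam[OF T(2)] mem by blast
  qed
  then obtain c where c: "\<And>l. l \<in> B \<Longrightarrow> c l \<in> used l" "\<And>l. l \<in> B \<Longrightarrow> Suc l + min_period (c l) \<le> lam (c l)"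
    by metis
  have cT: "c l \<in> T" if "l \<in> B" for l using c(1)[OF that] by (simp add: used_def)
  have finB: "finite B" by (simp add: B_def)
  \<comment> \<open>the orders at which the class is available but not used\<close>
  define D where "D X = {min_period X..<lam X - s X}" for X
  \<comment> \<open>If the two ranges met, both classes would be available, hence used, at the smaller tight order,
    and both would satisfy the hypothesis of \<open>no_two_long\<close>.\<close>
  have disj: "D (c b) \<inter> D (c b') = {}" if b: "b \<in> B" "b' \<in> B" and neq: "c b \<noteq> c b'" and le: "b \<le> b'" for b b'
  proof (rule ccontr)
    assume "D (c b) \<inter> D (c b') \<noteq> {}"
    then obtain l where l: "l < lam (c b) - s (c b)" "min_period (c b') \<le> l" by (auto simp: D_def)
    moreover have "lam (c b) - s (c b) \<le> b" using c(1)[OF b(1)] by (simp add: used_def)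
    moreover have long: "Suc b + min_period (c b') \<le> lam (c b')" using c(2)[OF b(2)] le by simp
    ultimately have "c b' \<in> available b" using cT[OF b(2)] by (simp add: available_def)
    moreover have "used b = available b"
      using b(1) card_available[of b] used_subset[of b] by (intro card_seteq) (auto simp: B_def)
    ultimately have "c b' \<in> used b" by simp
    then have "c b = c b'" using b(1) c[OF b(1)] long by (intro no_two_long[of b]) (auto simp: B_def)
    then show False using neq by simp
  qed
  have "card {l \<in> B. c l = X} \<le> card (D X)" if X: "X \<in> c ` B" for X
  proof -
    have XT: "X \<in> T" using X cT by blast
    have "{l \<in> B. c l = X} \<subseteq> {lam X - s X..<lam X - min_period X}" using c by (fastforce simp: used_def)
    then have "card {l \<in> B. c l = X} \<le> card {lam X - s X..<lam X - min_period X}" by (intro card_mono) auto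
    also have "\<dots> \<le> card (D X)" using s1[OF XT] s2[OF XT] by (simp add: D_def)
    finally show ?thesis .
  qed
  then have "(\<Sum>X\<in>c ` B. card {l \<in> B. c l = X}) \<le> (\<Sum>X\<in>c ` B. card (D X))" by (rule sum_mono)
  moreover have "card B = (\<Sum>X\<in>c ` B. card {l \<in> B. c l = X})"
    unfolding card_eq_sum by (rule sum.image_gen[OF finB])
  moreover have "card (\<Union>X\<in>c ` B. D X) = (\<Sum>X\<in>c ` B. card (D X))"
  proof (rule card_UN_disjoint)
    show "\<forall>X\<in>c ` B. \<forall>Y\<in>c ` B. X \<noteq> Y \<longrightarrow> D X \<inter> D Y = {}"
      using disj by (metis (no_types, lifting) imageE inf_commute nat_le_linear)
  qed (use finB in \<open>auto simp: D_def\<close>)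
  ultimately have BD: "card B \<le> card (\<Union>X\<in>c ` B. D X)" by simp
  define DD where "DD = (\<Union>X\<in>c ` B. D X)"
  have DN: "DD \<subseteq> {..<height}"
    using lam_less_height cT by (fastforce simp: DD_def D_def)
  have DD_surplus: "card (used l) \<le> growth l" "growth l \<noteq> 0" if l: "l \<in> DD" for l
  proof -
    obtain X where X: "X \<in> T" "min_period X \<le> l" "l < lam X - s X" using l cT by (auto simp: DD_def D_def)
    then have "X \<in> available l" "X \<notin> used l" by (auto simp: available_def used_def)
    then have "used l \<subset> available l" using used_subset by blast
    then have "card (used l) < card (available l)" by (intro psubset_card_mono) auto
    then show "card (used l) \<le> growth l" using card_available[of l] by simp
    show "growth l \<noteq> 0" using available_empty[of l] \<open>X \<in> available l\<close> by auto
  qed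
  \<comment> \<open>Order by order, the bound fails by one if the order is tight, and has one to spare in \<open>DD\<close>.\<close>
  have level: "2 * card (used l) + (if l \<in> DD then 1 else 0) \<le> 3 * growth l + (if l \<in> B then 1 else 0)" if "l < height" for l
  proof -
    consider "growth l = 0" | "growth l = 1" | "2 \<le> growth l" by linarith
    then show ?thesis
    proof cases
      case 2
      then consider "card (used l) \<le> 1" | "card (used l) = 2" using card_used(1)[of l] by linarith
      then show ?thesis using 2 DD_surplus[of l] that by cases (auto simp: B_def)
    qed (use card_used[of l] DD_surplus[of l] in auto)
  qed
  have "(\<Sum>l<height. 2 * card (used l) + (if l \<in> DD then 1 else 0)) \<le> (\<Sum>l<height. 3 * growth l + (if l \<in> B then 1 else 0))"
    using level by (intro sum_mono) simp
  moreover have "(\<Sum>l<height. if l \<in> DD then 1 else (0::nat)) = card DD"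
    using DN by (simp add: sum.If_cases Int_absorb1)
  moreover have "(\<Sum>l<height. if l \<in> B then 1 else (0::nat)) = card B"
  proof -
    have "B \<subseteq> {..<height}" by (auto simp: B_def)
    then show ?thesis by (simp add: sum.If_cases Int_absorb1)
  qed
  ultimately have "2 * (\<Sum>l<height. card (used l)) + card DD \<le> 3 * (\<Sum>l<height. growth l) + card B"
    by (simp add: sum.distrib sum_distrib_left)
  then show ?thesis using BD sum_growth unfolding DD_def[symmetric] sum_s by linarith
qed

end

section \<open>Counting all squares\<close>

text \<open>A fixed representative of the class of \<open>X\<close> under shifts.\<close>

definition rep :: "(int \<Rightarrow> 'a) \<Rightarrow> int \<Rightarrow> 'a" where
  "rep X = (SOME Y. shift_eq X Y)"

lemma shift_eq_rep: "shift_eq X (rep X)"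
  unfolding rep_def by (rule someI[of _ X]) simp

lemma rep_eq: "shift_eq X Y \<Longrightarrow> rep X = rep Y"
proof -
  assume "shift_eq X Y"
  then have "shift_eq X = shift_eq Y" by (blast intro: shift_eq_trans shift_eq_sym)
  then show ?thesis by (simp add: rep_def)
qed

lemma has_period_periodic_word: "x \<noteq> [] \<Longrightarrow> has_period (periodic_word x) (length x)"
  by (simp add: has_period_def periodic_word_period)

lemma fac_periodic_word: assumes "x \<noteq> []" shows "fac (periodic_word x) 1 (2 * length x) = x @ x"
proof (rule nth_equalityI)
  fix t assume "t < length (fac (periodic_word x) 1 (2 * length x))"
  then have t: "t < 2 * length x" by simp
  have "t mod length x = (if t < length x then t else t - length x)"
    using t by (auto simp: mod_if)
  then show "fac (periodic_word x) 1 (2 * length x) ! t = (x @ x) ! t"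
    using t by (simp add: fac_def periodic_word_def nth_append zmod_int[symmetric])
qed (simp add: mult_2)

text \<open>The square of \<open>x\<close> belongs to the class of the primitive root of \<open>x\<close>, represented by the periodic
  word with period word \<open>x\<close>.\<close>

lemma square_in_class:
  assumes W: "has_period W n" and x: "x \<noteq> []" and xx: "x @ x \<in> facs W (2 * length x)"
  defines "X \<equiv> rep (periodic_word x)"
  shows "\<exists>i k. 0 < k \<and> length x = k * min_period X \<and> x @ x = fac X i (2 * k * min_period X)" and "has_period X (min_period X)"
proof -
  have P: "has_period (periodic_word x) (length x)" using x by (rule has_period_periodic_word)
  have sh: "shift_eq (periodic_word x) X" unfolding X_def by (rule shift_eq_rep)
  then have PX: "has_period X (length x)" using P has_period_shift_eq by blast
  then show "has_period X (min_period X)" by (rule has_period_min_period)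
  obtain k where k: "length x = k * min_period X" using min_period_dvd[OF PX] by (metis dvd_def mult.commute)
  have "x @ x \<in> facs X (2 * length x)"
    using fac_periodic_word[OF x] facs_shift_eq[OF sh] by (metis fac_in_facs)
  then obtain i where "x @ x = fac X i (2 * length x)" by (auto simp: facs_def)
  moreover have "0 < k" using x k by (cases k) auto
  ultimately show "\<exists>i k. 0 < k \<and> length x = k * min_period X \<and> x @ x = fac X i (2 * k * min_period X)"
    using k by (intro exI[of _ i] exI[of _ k]) (simp add: mult.assoc)
qed

text \<open>The squares of length at most \<open>n\<close> that are factors of \<open>W\<close>.\<close>

definition periodic_squares :: "(int \<Rightarrow> 'a) \<Rightarrow> nat \<Rightarrow> 'a list set" where
  "periodic_squares W n = {x @ x |x. x \<noteq> [] \<and> 2 * length x \<le> n \<and> x @ x \<in> facs W (2 * length x)}"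

lemma card_periodic_squares:
  assumes Wn: "has_period W n"
  shows "2 * card (periodic_squares W n) \<le> 3 * n"
proof -
  have W: "has_period W (min_period W)" using Wn by (rule has_period_min_period)
  define S where "S = periodic_squares W n"
  have finS: "finite S"
  proof (rule finite_subset)
    show "S \<subseteq> (\<Union>l\<le>n. facs W l)" by (auto simp: S_def periodic_squares_def)
    show "finite (\<Union>l\<le>n. facs W l)" using finite_facs(1)[OF W] by auto
  qed
  define root where "root z = rep (periodic_word (take (length z div 2) z))" for z :: "'a list"
  have root: "root (x @ x) = rep (periodic_word x)" for x by (simp add: root_def)
  define T where "T = {X \<in> root ` S. \<not> shift_eq W X}"
  have finT: "finite T" using finS by (simp add: T_def)
  have ST: "\<exists>x i k. z = x @ x \<and> X = rep (periodic_word x) \<and> x \<noteq> [] \<and> 0 < k \<and> length x = k * min_period X \<and> 2 * k * min_period X \<le> n \<and>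
      z = fac X i (2 * k * min_period X) \<and> z \<in> facs W (2 * k * min_period X) \<and> has_period X (min_period X)" if "z \<in> S" "X = root z" for z X
  proof -
    obtain x where x: "z = x @ x" "x \<noteq> []" "2 * length x \<le> n" "x @ x \<in> facs W (2 * length x)"
      using \<open>z \<in> S\<close> by (auto simp: S_def periodic_squares_def)
    have X: "X = rep (periodic_word x)" using that x root by simp
    show ?thesis
      using square_in_class[OF W x(2,4)] x unfolding X[symmetric] by (metis X mult.assoc)
  qed
  have TS: "class_squares W n X \<noteq> {}" "has_period X (min_period X)" if X: "X \<in> T" for X
  proof -
    obtain z where z: "z \<in> S" "X = root z" using X by (auto simp: T_def)
    from ST[OF this] obtain i k where ik: "0 < k" "2 * k * min_period X \<le> n" "z = fac X i (2 * k * min_period X)"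
        "z \<in> facs W (2 * k * min_period X)" and p: "has_period X (min_period X)"
      by (elim exE conjE) (rule that)
    have "z \<in> class_squares W n X" using ik by (rule class_squaresI)
    then show "class_squares W n X \<noteq> {}" by blast
    show "has_period X (min_period X)" by (rule p)
  qed
  have neT: "\<not> shift_eq W X" if "X \<in> T" for X using that by (simp add: T_def)
  have inequiv: "X = Y" if XY: "X \<in> T" "Y \<in> T" "shift_eq X Y" for X Y
  proof -
    obtain A B where AB: "X = rep A" "Y = rep B" using XY by (auto simp: T_def root_def)
    then have "shift_eq A B" using XY(3) by (metis shift_eq_rep shift_eq_sym shift_eq_trans)
    then show ?thesis using AB rep_eq by blast
  qed
  have "\<forall>X\<in>T. \<exists>s lam. (\<forall>L. facs X L \<subseteq> facs W L \<longleftrightarrow> L \<le> lam) \<and> card (class_squares W n X) \<le> s \<and>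
    2 * s \<le> lam \<and> s + min_period X \<le> lam \<and> (min_period X < s \<longrightarrow> s + 2 * min_period X \<le> lam)"
    using class_bounds[OF W TS(2) neT TS(1)] by blast
  then obtain s lam where sl: "\<And>X. X \<in> T \<Longrightarrow> (\<forall>L. facs X L \<subseteq> facs W L \<longleftrightarrow> L \<le> lam X) \<and>
      card (class_squares W n X) \<le> s X \<and> 2 * s X \<le> lam X \<and> s X + min_period X \<le> lam X \<and>
      (min_period X < s X \<longrightarrow> s X + 2 * min_period X \<le> lam X)"
    by metis
  interpret circuit_family W T s lam
    by unfold_locales (use W finT TS(2) neT inequiv sl in auto)
  \<comment> \<open>the squares whose primitive root is a conjugate of the period word of \<open>W\<close>; none if \<open>min_period W = n\<close>\<close>
  define S0 where "S0 = (\<lambda>(i, k). fac W (int i) (2 * k * min_period W)) ` ({..<min_period W} \<times> {1..n div (2 * min_period W)})"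
  have m0: "0 < min_period W" using has_period_pos[OF W] .
  have cover: "S \<subseteq> (\<Union>X\<in>T. class_squares W n X) \<union> S0"
  proof
    fix z assume z: "z \<in> S"
    obtain i k where ik: "0 < k" "2 * k * min_period (root z) \<le> n" "z = fac (root z) i (2 * k * min_period (root z))"
        "z \<in> facs W (2 * k * min_period (root z))"
      using ST[OF z refl] by (elim exE conjE) (rule that)
    show "z \<in> (\<Union>X\<in>T. class_squares W n X) \<union> S0"
    proof (cases "shift_eq W (root z)")
      case False
      then have "root z \<in> T" using z by (simp add: T_def)
      moreover have "z \<in> class_squares W n (root z)" using ik by (rule class_squaresI)
      ultimately show ?thesis by blast
    next
      case True
      then have m: "min_period (root z) = min_period W" using min_period_shift_eq by metis
      obtain j where j: "z = fac W j (2 * k * min_period W)" using ik(4) m by (auto simp: facs_def)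
      let ?t = "nat (j mod int (min_period W))"
      have "z = fac W (int ?t) (2 * k * min_period W)" using j fac_mod[OF W] by simp
      moreover have "?t < min_period W" using m0 by (simp add: nat_less_iff)
      moreover have "k \<le> n div (2 * min_period W)" using ik(2) m0 by (simp add: m less_eq_div_iff_mult_less_eq algebra_simps)
      ultimately show ?thesis using ik(1) by (force simp: S0_def)
    qed
  qed
  have "card S \<le> card ((\<Union>X\<in>T. class_squares W n X) \<union> S0)"
  proof (rule card_mono[OF _ cover])
    have "class_squares W n X \<subseteq> (\<Union>l\<le>n. facs W l)" for X by (auto simp: class_squares_def)
    moreover have "finite (\<Union>l\<le>n. facs W l)" using finite_facs(1)[OF W] by auto
    ultimately show "finite ((\<Union>X\<in>T. class_squares W n X) \<union> S0)"
      using finT finite_subset by (fastforce simp: S0_def)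
  qed
  also have "\<dots> \<le> card (\<Union>X\<in>T. class_squares W n X) + card S0" by (rule card_Un_le)
  also have "card (\<Union>X\<in>T. class_squares W n X) \<le> (\<Sum>X\<in>T. card (class_squares W n X))"
    using finT by (rule card_UN_le)
  also have "\<dots> \<le> (\<Sum>X\<in>T. s X)" using sl by (intro sum_mono) blast
  finally have total: "card S \<le> (\<Sum>X\<in>T. s X) + card S0" by simp
  have S0: "card S0 \<le> min_period W * (n div (2 * min_period W))"
    unfolding S0_def by (rule order.trans[OF card_image_le]) auto
  have dvd: "min_period W dvd n" using Wn by (rule min_period_dvd)
  have n0: "0 < n" using has_period_pos[OF Wn] .
  show ?thesis
  proof (cases "min_period W = n")
    case True
    have "2 * min_period X < min_period W" if X: "X \<in> T" for X
    proof -
      obtain z where z: "z \<in> S" "X = root z" using X by (auto simp: T_def)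
      obtain i k where ik: "0 < k" "2 * k * min_period X \<le> n" "z = fac X i (2 * k * min_period X)"
        "z \<in> facs W (2 * k * min_period X)"
        using ST[OF z] by (elim exE conjE) (rule that)
      have le: "2 * min_period X \<le> 2 * k * min_period X" using ik(1) by simp
      \<comment> \<open>Otherwise the square is a full period word of \<open>W\<close>, and \<open>W\<close> has the smaller period \<open>min_period X\<close>.\<close>
      have "2 * min_period X \<noteq> n"
      proof
        assume eq: "2 * min_period X = n"
        then have "2 * k * min_period X = n" using le ik(2) by simp
        then obtain j where "fac W j n = fac X i n" using ik by (auto simp: facs_def)
        moreover have "has_period X n"
          using TS(2)[OF X] has_period_mult[OF TS(2)[OF X], of _ 2] n0 eq by (auto simp: has_period_def mult.commute)
        ultimately have "shift_eq W X" using Wn by (intro shift_eq_of_fac_eq[of W n X j n i]) auto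
        then show False using neT[OF X] by simp
      qed
      then show ?thesis using le ik(2) True by linarith
    qed
    then have "2 * (\<Sum>X\<in>T. s X) \<le> 3 * (min_period W - 1)" by (rule main_bound)
    moreover have "card S0 = 0" using S0 True m0 by simp
    ultimately show ?thesis using total True unfolding S_def by simp
  next
    case False
    then obtain e where e: "n = min_period W * e" using dvd by (auto simp: dvd_def)
    then have "2 \<le> e" using False n0 by (cases e) (auto simp: Suc_le_eq)
    then have "min_period W * 2 \<le> n" unfolding e by (rule mult_le_mono2)
    moreover have "2 * (min_period W * (n div (2 * min_period W))) \<le> n"
      using times_div_less_eq_dividend[of "2 * min_period W" n] by (simp add: mult.assoc)
    ultimately show ?thesis using total S0 crude_bound unfolding S_def by linarith
  qed
qed

lemma cyclic_squares_eq:
  assumes "w \<noteq> []"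
  shows "cyclic_squares w = periodic_squares (periodic_word w) (length w)"
proof -
  have fac_map: "map W [a..b] = fac W a (nat (b - a + 1))" for W :: "int \<Rightarrow> 'a" and a b
    by (rule nth_equalityI) (auto simp: fac_def)
  have "factor u W \<longleftrightarrow> u \<in> facs W (length u)" for u and W :: "int \<Rightarrow> 'a"
  proof
    assume "factor u W"
    then show "u \<in> facs W (length u)" unfolding factor_def fac_map by auto
  next
    assume "u \<in> facs W (length u)"
    then obtain i where "u = fac W i (length u)" by (auto simp: facs_def)
    then have "u = map W [i..i + int (length u) - 1]" unfolding fac_map by simp
    then show "factor u W" unfolding factor_def by blast
  qed
  then show ?thesis
    unfolding cyclic_squares_def periodic_squares_def square_def by (auto simp: mult_2)
qed

theorem theorem1p1:
  fixes A :: "'a set" and w :: "'a list" and n :: nat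
  assumes "finite A"
    and "w \<in> lists A"
    and "w \<noteq> []"
    and "n = length w"
  shows "int (num_cyclic_squares w) \<le> \<lfloor>3 * real n / 2\<rfloor>"
proof -
  have "has_period (periodic_word w) n"
    using assms(3,4) periodic_word_period[of w] by (simp add: has_period_def)
  then have "2 * num_cyclic_squares w \<le> 3 * n"
    using card_periodic_squares cyclic_squares_eq[OF assms(3)] assms(4)
    by (simp add: num_cyclic_squares_def)
  then have "real (num_cyclic_squares w) \<le> 3 * real n / 2" by linarith
  then show ?thesis by (simp add: le_floor_iff)
qed

end
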